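(* Let $M,N$ be positive integers, let $\eta > 0$, and let $C_1 > 1$ and $C_2 > 1$ be constants. Let $Y_1, Y_2, \dots, Y_\ell, \dots$ be a sequence of finite subsets of $\mathbb{Z}^N$ such that $$C_1^{\ell} \le |Y_\ell| \quad\text{for each } \ell = 1, 2, \dots,$$ and write $$\mathcal{X} = \bigcup_{\ell=1}^\infty \bigl\{X \subseteq Y_\ell : |Y_\ell| \le C_2 |X|\bigr\}.$$ Then for $\mu_1$-almost all points $A$ in $G_1 = (\mathbb{R}/\mathbb{Z})^{MN}$, the inequality $$\sum_{\substack{\xi \in X\\ \xi \ne 0}} F(A\xi) \ll_{A, \eta, M} |X| \bigl(\log 3|X|\bigr)^{M+1} \bigl(\log\log 27|X|\bigr)^{1+\eta}$$ holds for all subsets $X$ in $\mathcal{X}$.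
   Context: For $x \in \mathbb{R}/\mathbb{Z}$, $\|x\|$ is the distance from (any real representative of) $x$ to the nearest integer. Elements of $G_1 = (\mathbb{R}/\mathbb{Z})^{MN}$ are written as $M\times N$ matrices $A = (\alpha_{mn})$ with entries in $\mathbb{R}/\mathbb{Z}$, and $\mu_1$ is the Haar measure on the Borel subsets of $G_1$ normalized so that $\mu_1(G_1)=1$. Elements of $G_2 = (\mathbb{R}/\mathbb{Z})^M$ are written as column vectors. For a column vector $\xi \in \mathbb{Z}^N$, $A\xi = \bigl(\sum_{n=1}^N \alpha_{mn}\xi_n\bigr)_{1\le m\le M} \in G_2$. The function $F : G_2 \to [1,\infty]$ is $F(x) = \prod_{m=1}^M (2\|x_m\|)^{-1}$, with value $+\infty$ if some $\|x_m\|=0$. The notation $\ll_{A,\eta,M}$ means: with $N$, $C_1$, $C_2$ and the sequence $(Y_\ell)$ fixed beforehand, there is a finite positive constant $c$ depending on $A$, $\eta$, $M$ (and on the fixed data) but not on $X$, such that the left side is at most $c$ times the right side for every $X\in\mathcal{X}$. *)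

theory Defs
  imports "HOL-Analysis.Analysis"
begin

section \<open>The group \<open>\<real>/\<int>\<close>\<close>

quotient_type circle = real / "\<lambda>x y::real. x - y \<in> \<int>"
  morphisms rep_circle to_circle
proof (rule equivpI)
  show "reflp (\<lambda>x y::real. x - y \<in> \<int>)"
    by (simp add: reflp_def)
  show "symp (\<lambda>x y::real. x - y \<in> \<int>)"
    unfolding symp_def by (metis Ints_minus minus_diff_eq)
  show "transp (\<lambda>x y::real. x - y \<in> \<int>)"
    unfolding transp_def by (metis Ints_add diff_add_cancel add_diff_eq)
qed

instantiation circle :: ab_group_add
begin

lift_definition zero_circle :: circle is "0::real" .

lift_definition plus_circle :: "circle \<Rightarrow> circle \<Rightarrow> circle" is "(+) :: real \<Rightarrow> _"
proof -
  fix a b c d :: real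
  assume "a - b \<in> \<int>" "c - d \<in> \<int>"
  then have "(a - b) + (c - d) \<in> \<int>" by (rule Ints_add)
  then show "a + c - (b + d) \<in> \<int>" by (simp add: algebra_simps)
qed

lift_definition uminus_circle :: "circle \<Rightarrow> circle" is "uminus :: real \<Rightarrow> _"
  by (metis Ints_minus minus_diff_minus)

lift_definition minus_circle :: "circle \<Rightarrow> circle \<Rightarrow> circle" is "(-) :: real \<Rightarrow> _"
proof -
  fix a b c d :: real
  assume "a - b \<in> \<int>" "c - d \<in> \<int>"
  then have "(a - b) - (c - d) \<in> \<int>" by (rule Ints_diff)
  then show "a - c - (b - d) \<in> \<int>" by (simp add: algebra_simps)
qed

instance
  by standard (transfer; simp add: algebra_simps)+

end

text \<open>The quotient topology.\<close>

instantiation circle :: topological_space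
begin

definition open_circle :: "circle set \<Rightarrow> bool" where
  "open_circle U \<longleftrightarrow> open (to_circle -` U)"

instance
  by standard (auto simp: open_circle_def vimage_Union)

end

lift_definition int_scale :: "int \<Rightarrow> circle \<Rightarrow> circle" is "\<lambda>k x. of_int k * x"
  by (metis Ints_mult Ints_of_int right_diff_distrib)

lift_definition circle_norm :: "circle \<Rightarrow> real" is "\<lambda>x. infdist x \<int>"
proof -
  have le: "infdist x \<int> \<le> infdist y \<int>" if "x - y \<in> \<int>" for x y :: real
  proof -
    have "infdist x \<int> \<le> dist y a" if "a \<in> \<int>" for a
    proof -
      have "infdist x \<int> \<le> dist x (a + (x - y))"
        using \<open>x - y \<in> \<int>\<close> that by (intro infdist_le Ints_add)
      then show ?thesis by (simp add: dist_real_def)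
    qed
    then show ?thesis
      by (subst (2) infdist_notempty) (auto intro!: cINF_greatest intro: Ints_0)
  qed
  fix x y :: real
  assume "x - y \<in> \<int>"
  moreover from this have "y - x \<in> \<int>" by (metis Ints_minus minus_diff_eq)
  ultimately show "infdist x \<int> = infdist y \<int>" using le by (metis antisym)
qed

section \<open>The map \<open>\<xi> \<mapsto> A\<xi>\<close> and the function \<open>F\<close>\<close>

text \<open>
  \<open>G\<^sub>1\<close> is \<open>circle ^ 'n ^ 'm\<close> (an \<open>M \<times> N\<close> matrix, entry \<open>\<alpha>\<^sub>m\<^sub>n = A $ m $ n\<close>), and \<open>G\<^sub>2\<close> is \<open>circle ^ 'm\<close>,
  with \<open>M = CARD('m)\<close> and \<open>N = CARD('n)\<close>.
\<close>

definition mat_int_mult :: "circle ^ 'n ^ 'm \<Rightarrow> int ^ 'n \<Rightarrow> circle ^ 'm" where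
  "mat_int_mult A \<xi> = (\<chi> m. \<Sum>n\<in>UNIV. int_scale (\<xi> $ n) (A $ m $ n))"

text \<open>
  In \<open>ennreal\<close> we have \<open>inverse 0 = \<infinity>\<close>. As \<open>2 \<parallel>x\<parallel> \<le> 1\<close>, every factor is at least \<open>1\<close>, so the
  convention \<open>0 * \<infinity> = 0\<close> never applies.
\<close>

definition F :: "circle ^ 'm \<Rightarrow> ennreal" where
  "F x = (\<Prod>m\<in>UNIV. inverse (ennreal (2 * circle_norm (x $ m))))"

section \<open>Normalized Haar measure\<close>

text \<open>
  A finite Borel measure on a compact metrizable group is automatically regular, so regularity is
  not part of the definition.
\<close>

definition normalized_haar_measure :: "'g::{ab_group_add, topological_space} measure \<Rightarrow> bool" where
  "normalized_haar_measure \<mu> \<longleftrightarrow>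
     sets \<mu> = sets borel \<and> emeasure \<mu> UNIV = 1 \<and>
     (\<forall>g. \<forall>B\<in>sets borel. emeasure \<mu> ((\<lambda>x. g + x) ` B) = emeasure \<mu> B)"

text \<open>
  On \<open>circle ^ 'n ^ 'm\<close> such a measure exists: it is the image of Lebesgue measure on the
  half-open unit cube.
\<close>

definition to_torus :: "real ^ 'n ^ 'm \<Rightarrow> circle ^ 'n ^ 'm" where
  "to_torus x = (\<chi> i j. to_circle (x $ i $ j))"

definition unit_cube :: "(real ^ 'n ^ 'm) set" where
  "unit_cube = {x. \<forall>i j. 0 \<le> x $ i $ j \<and> x $ i $ j < 1}"

definition lattice_vec :: "int ^ 'n ^ 'm \<Rightarrow> real ^ 'n ^ 'm" where
  "lattice_vec z = (\<chi> i j. of_int (z $ i $ j))"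

lemma to_circle_add: "to_circle (x + y) = to_circle x + to_circle y"
  by (simp add: plus_circle.abs_eq)

lemma to_circle_of_int: "to_circle (of_int k) = 0"
  by (simp add: zero_circle_def circle.abs_eq_iff)

lemma to_torus_add: "to_torus (x + y) = to_torus x + to_torus y"
  by (simp add: to_torus_def vec_eq_iff to_circle_add)

lemma to_torus_lattice_vec: "to_torus (lattice_vec z) = 0"
  by (simp add: to_torus_def lattice_vec_def vec_eq_iff to_circle_of_int)

lemma surj_to_torus: "\<exists>t. to_torus t = g"
proof -
  have "to_torus (\<chi> i j. rep_circle (g $ i $ j)) = g"
    by (simp add: to_torus_def vec_eq_iff Quotient_abs_rep[OF Quotient_circle])
  then show ?thesis ..
qed

lemma continuous_to_torus: "continuous_on UNIV to_torus"
proof -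
  have "continuous_on UNIV to_circle"
    by (simp add: continuous_on_open_vimage flip: open_circle_def)
  then have "(to_circle \<longlongrightarrow> to_circle a) (at a)" for a
    by (simp add: continuous_on_def)
  then have *: "isCont to_circle a" for a
    by (simp add: isCont_def)
  show ?thesis
    unfolding to_torus_def continuous_on_def
    by (auto intro!: tendsto_vec_lambda isCont_tendsto_compose[OF *] tendsto_intros)
qed

lemma continuous_on_circle_diff: "continuous_on UNIV (\<lambda>x::circle. x - h)"
proof -
  obtain t where t: "to_circle t = h"
    using Quotient_abs_rep[OF Quotient_circle] by blast
  have "open ((\<lambda>x. x - h) -` U)" if "open U" for U
  proof -
    have "open (to_circle -` U)" using that by (simp add: open_circle_def)
    then have "open ((\<lambda>x. x - t) -` (to_circle -` U))"
      by (rule open_vimage) (intro continuous_intros)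
    also have "(\<lambda>x. x - t) -` (to_circle -` U) = to_circle -` ((\<lambda>x. x - h) -` U)"
      by (auto simp: t[symmetric] minus_circle.abs_eq)
    finally show ?thesis by (simp add: open_circle_def)
  qed
  then show ?thesis by (simp add: continuous_on_open_vimage)
qed

lemma continuous_on_torus_diff: "continuous_on UNIV (\<lambda>x::circle^'n^'m. x - g)"
proof -
  have "continuous_on UNIV (\<lambda>x::circle^'n^'m. x $ i $ j)" for i j
    unfolding continuous_on_def by (intro ballI tendsto_vec_nth tendsto_ident_at)
  then have "continuous_on UNIV (\<lambda>x::circle^'n^'m. x $ i $ j - g $ i $ j)" for i j
    by (rule continuous_on_compose2[OF continuous_on_circle_diff]) simp
  then have "continuous_on UNIV (\<lambda>x::circle^'n^'m. \<chi> i j. x $ i $ j - g $ i $ j)"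
    unfolding continuous_on_def by (auto intro!: tendsto_vec_lambda)
  also have "(\<lambda>x::circle^'n^'m. \<chi> i j. x $ i $ j - g $ i $ j) = (\<lambda>x. x - g)"
    by (simp add: fun_eq_iff vec_eq_iff)
  finally show ?thesis .
qed

lemma sets_unit_cube [measurable]: "unit_cube \<in> sets borel"
proof -
  have "{x::real^'n^'m. 0 \<le> x $ i $ j \<and> x $ i $ j < 1} \<in> sets borel" for i j
  proof -
    have "(\<lambda>x::real^'n^'m. x $ i $ j) \<in> borel_measurable borel"
      by (intro borel_measurable_continuous_onI continuous_intros)
    then show ?thesis by measurable
  qed
  then have "(\<Inter>i. \<Inter>j. {x::real^'n^'m. 0 \<le> x $ i $ j \<and> x $ i $ j < 1}) \<in> sets borel"
    by (intro sets.finite_INT) auto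
  also have "(\<Inter>i. \<Inter>j. {x::real^'n^'m. 0 \<le> x $ i $ j \<and> x $ i $ j < 1}) = unit_cube"
    by (auto simp: unit_cube_def)
  finally show ?thesis .
qed

lemma emeasure_unit_cube: "emeasure lborel (unit_cube :: (real ^ 'n ^ 'm) set) = 1"
proof -
  define e :: "real ^ 'n ^ 'm" where "e = (\<chi> i j. 1)"
  have e: "e \<bullet> b = 1" if "b \<in> Basis" for b
    using that by (auto simp: Basis_vec_def inner_axis e_def)
  have "box 0 e \<subseteq> unit_cube"
    by (auto simp: unit_cube_def box_def Basis_vec_def inner_axis e_def intro: less_imp_le)
  then have "emeasure lborel (box 0 e) \<le> emeasure lborel (unit_cube :: (real ^ 'n ^ 'm) set)"
    by (intro emeasure_mono) (auto simp: sets_unit_cube)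
  moreover have "unit_cube \<subseteq> cbox 0 e"
    by (auto simp: unit_cube_def cbox_def Basis_vec_def inner_axis e_def intro: less_imp_le)
  then have "emeasure lborel (unit_cube :: (real ^ 'n ^ 'm) set) \<le> emeasure lborel (cbox 0 e)"
    by (intro emeasure_mono) auto
  ultimately show ?thesis
    by (simp add: e emeasure_lborel_cbox_eq emeasure_lborel_box_eq)
qed

lemma emeasure_lborel_shift:
  fixes c :: "'a::euclidean_space"
  assumes "S \<in> sets borel"
  shows "emeasure lborel ((\<lambda>x. c + x) -` S) = emeasure lborel S"
proof -
  have "emeasure lborel S = emeasure (distr lborel borel ((+) c)) S"
    by (simp add: lborel_distr_plus)
  also have "\<dots> = emeasure lborel ((\<lambda>x. c + x) -` S)"
    using assms by (subst emeasure_distr) auto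
  finally show ?thesis ..
qed

lemma lattice_tiling: "\<exists>!z. x - lattice_vec z \<in> unit_cube"
proof
  show "x - lattice_vec (\<chi> i j. \<lfloor>x $ i $ j\<rfloor>) \<in> unit_cube"
    by (simp add: unit_cube_def lattice_vec_def) linarith
next
  fix z assume "x - lattice_vec z \<in> unit_cube"
  then have "of_int (z $ i $ j) \<le> x $ i $ j \<and> x $ i $ j < of_int (z $ i $ j) + 1" for i j
    by (auto simp: unit_cube_def lattice_vec_def algebra_simps)
  then have "\<lfloor>x $ i $ j\<rfloor> = z $ i $ j" for i j
    by (intro floor_unique) auto
  then show "z = (\<chi> i j. \<lfloor>x $ i $ j\<rfloor>)"
    by (simp add: vec_eq_iff)
qed

lemma emeasure_periodic_shift:
  fixes S :: "(real ^ 'n ^ 'm) set"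
  assumes S: "S \<in> sets borel" and periodic: "\<And>x z. x + lattice_vec z \<in> S \<longleftrightarrow> x \<in> S"
  shows "emeasure lborel {x \<in> S. x + t \<in> unit_cube} = emeasure lborel (S \<inter> unit_cube)"
proof -
  note [measurable] = S
  define P where "P z = {x \<in> S. x + t \<in> unit_cube \<and> x - lattice_vec z \<in> unit_cube}" for z
  define R where "R z = {x \<in> S. x \<in> unit_cube \<and> x + t + lattice_vec z \<in> unit_cube}" for z
  have meas: "P z \<in> sets borel" "R z \<in> sets borel" for z
    unfolding P_def R_def by measurable
  have "{x \<in> S. x + t \<in> unit_cube} = (\<Union>z. P z)"
    using lattice_tiling by (fastforce simp: P_def)
  moreover have "disjoint_family P"
    using lattice_tiling by (fastforce simp: P_def disjoint_family_on_def)
  ultimately have 1: "emeasure lborel {x \<in> S. x + t \<in> unit_cube} =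
      (\<integral>\<^sup>+z. emeasure lborel (P z) \<partial>count_space UNIV)"
    using emeasure_UN_countable[of UNIV P lborel] meas by simp
  have neg: "lattice_vec (- z) = - lattice_vec z" for z :: "int ^ 'n ^ 'm"
    by (simp add: lattice_vec_def vec_eq_iff)
  have "\<exists>z. x + t + lattice_vec z \<in> unit_cube" for x
    using lattice_tiling[of "x + t"] neg by (metis diff_conv_add_uminus)
  then have "S \<inter> unit_cube = (\<Union>z. R z)"
    by (auto simp: R_def)
  moreover have "disjoint_family R"
  proof -
    have "z = w" if "x + t + lattice_vec z \<in> unit_cube" "x + t + lattice_vec w \<in> unit_cube" for x z w
    proof -
      have "- z = - w"
        using lattice_tiling[of "x + t"] that by (metis neg diff_minus_eq_add)
      then show ?thesis by simp
    qed
    then show ?thesis by (fastforce simp: R_def disjoint_family_on_def)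
  qed
  ultimately have 2: "emeasure lborel (S \<inter> unit_cube) =
      (\<integral>\<^sup>+z. emeasure lborel (R z) \<partial>count_space UNIV)"
    using emeasure_UN_countable[of UNIV R lborel] meas by simp
  have "R z = (\<lambda>x. lattice_vec z + x) -` P z" for z
    using periodic[of _ z] by (auto simp: P_def R_def algebra_simps)
  then have "emeasure lborel (R z) = emeasure lborel (P z)" for z
    using emeasure_lborel_shift[OF meas(1)] by simp
  then show ?thesis using 1 2 by simp
qed

lemma normalized_haar_measure_exists:
  "\<exists>\<mu> :: (circle ^ 'n ^ 'm) measure. normalized_haar_measure \<mu>"
proof
  define \<mu> :: "(circle ^ 'n ^ 'm) measure"
    where "\<mu> = distr (restrict_space lborel unit_cube) borel to_torus"
  have [measurable]: "to_torus \<in> borel_measurable borel"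
    by (rule borel_measurable_continuous_onI[OF continuous_to_torus])
  have emeasure_\<mu>: "emeasure \<mu> B = emeasure lborel (to_torus -` B \<inter> unit_cube)"
    if "B \<in> sets borel" for B
  proof -
    have "to_torus \<in> restrict_space lborel unit_cube \<rightarrow>\<^sub>M borel"
      by (intro measurable_restrict_space1) simp
    then show ?thesis
      unfolding \<mu>_def using that
      by (subst emeasure_distr)
        (auto simp: space_restrict_space emeasure_restrict_space sets_unit_cube)
  qed
  show "normalized_haar_measure \<mu>"
    unfolding normalized_haar_measure_def
  proof (intro conjI allI ballI)
    show "sets \<mu> = sets borel" by (simp add: \<mu>_def)
    show "emeasure \<mu> UNIV = 1"
      by (simp add: emeasure_\<mu> emeasure_unit_cube)
  next
    fix g :: "circle ^ 'n ^ 'm" and B :: "(circle ^ 'n ^ 'm) set"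
    assume B: "B \<in> sets borel"
    obtain t where t: "to_torus t = g" using surj_to_torus by blast
    have cont: "continuous_on UNIV (\<lambda>x. x - g)"
      by (rule continuous_on_torus_diff)
    have "(\<lambda>x. g + x) ` B = (\<lambda>x. x - g) -` B"
      by (auto simp: image_iff) (metis add_diff_cancel_left' diff_add_cancel add.commute)+
    moreover from cont have "(\<lambda>x. x - g) -` B \<in> sets borel"
      using B by (metis borel_measurable_continuous_onI measurable_sets_borel)
    ultimately have gB: "(\<lambda>x. g + x) ` B \<in> sets borel" by simp
    define S where "S = to_torus -` B"
    have S: "S \<in> sets borel"
      unfolding S_def using B by (rule measurable_sets_borel[rotated]) simp
    have periodic: "x + lattice_vec z \<in> S \<longleftrightarrow> x \<in> S" for x z
      by (simp add: S_def to_torus_add to_torus_lattice_vec)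
    have eq: "{x \<in> S. x + t \<in> unit_cube}
        = (\<lambda>x. t + x) -` (to_torus -` ((\<lambda>x. g + x) ` B) \<inter> unit_cube)"
      by (auto simp: S_def to_torus_add t add.commute)
    have "to_torus -` ((\<lambda>x. g + x) ` B) \<inter> unit_cube \<in> sets borel"
      using gB measurable_sets_borel[of to_torus borel] by (auto simp: sets_unit_cube)
    then have "emeasure lborel (to_torus -` ((\<lambda>x. g + x) ` B) \<inter> unit_cube) =
        emeasure lborel {x \<in> S. x + t \<in> unit_cube}"
      by (subst eq) (rule emeasure_lborel_shift[symmetric])
    also have "\<dots> = emeasure lborel (to_torus -` B \<inter> unit_cube)"
      using emeasure_periodic_shift[OF S periodic, of t] by (simp add: S_def)
    finally show "emeasure \<mu> ((\<lambda>x. g + x) ` B) = emeasure \<mu> B"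
      by (simp add: emeasure_\<mu> gB B)
  qed
qed

end

theory Submission
  imports Defs
begin

text \<open>
  Replace \<open>F\<close> by a truncation: each \<open>\<parallel>x\<^sub>m\<parallel>\<close> is replaced by its maximum with \<open>1/q\<close>, where
  \<open>q = |Y\<^sub>\<ell>|\<^sup>2\<close>. The points \<open>A\<close> for which this changes the sum over \<open>Y\<^sub>\<ell>\<close> have measure at most
  \<open>|Y\<^sub>\<ell>| M \<cdot> 2/q = 2M/|Y\<^sub>\<ell>|\<close>, which is summable in \<open>\<ell>\<close>, so by Borel--Cantelli almost every \<open>A\<close> is
  affected by finitely many \<open>\<ell>\<close> only. The truncated sum over \<open>Y\<^sub>\<ell>\<close> has integral
  \<open>O(|Y\<^sub>\<ell>| (log |Y\<^sub>\<ell>|)\<^sup>M)\<close>; divided by the claimed bound this is \<open>O(1/(\<ell> (log \<ell>)\<^sup>1\<^sup>+\<^sup>\<eta>))\<close>, whose sum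
  converges, so the normalized sums are bounded for almost every \<open>A\<close>. Both estimates use nothing of
  the Haar measure beyond invariance: \<open>A \<mapsto> A\<xi>\<close> is onto for \<open>\<xi> \<noteq> 0\<close>, so integrals may be averaged over
  translates of \<open>A\<xi>\<close> by the finite grid \<open>(1/q)\<int>\<^sup>M\<close>, and grid averages are bounded by harmonic sums.
\<close>

section \<open>The norm on the circle\<close>

lemma to_circle_rep_circle: "to_circle (rep_circle x) = x"
  by (rule Quotient_abs_rep[OF Quotient_circle])

lemma circle_norm_to_circle: "circle_norm (to_circle x) = infdist x \<int>"
  by (rule circle_norm.abs_eq)

lemma circle_norm_nonneg [simp]: "0 \<le> circle_norm x"
  by transfer (rule infdist_nonneg)

lemma circle_norm_0 [simp]: "circle_norm 0 = 0"
  by transfer (simp add: infdist_zero Ints_0)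

text \<open>The integers are closed, so a nearest one exists, and subtracting it from a
  representative gives \<open>t\<close>. The norm inequalities below are proved by computing with
  such optimal representatives.\<close>

lemma circle_norm_attained:
  obtains t where "to_circle t = x" "circle_norm x = \<bar>t\<bar>"
proof -
  have "closed (\<int> :: real set)" by (rule closed_Ints)
  then obtain k where k: "k \<in> \<int>" "infdist (rep_circle x) \<int> = dist (rep_circle x) k"
    using infdist_attains_inf[of \<int> "rep_circle x"] Ints_0 by blast
  have "to_circle (rep_circle x - k) = to_circle (rep_circle x)"
    using k(1) by (simp add: circle.abs_eq_iff)
  moreover have "circle_norm x = \<bar>rep_circle x - k\<bar>"
    using k(2) circle_norm_to_circle[of "rep_circle x"] by (simp add: to_circle_rep_circle dist_real_def)
  ultimately show ?thesis using that by (simp add: to_circle_rep_circle)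
qed

lemma circle_norm_le_abs: "circle_norm (to_circle t) \<le> \<bar>t\<bar>"
  using infdist_le[of 0 \<int> t] by (simp add: circle_norm_to_circle Ints_0)

lemma circle_norm_triangle: "circle_norm (x + y) \<le> circle_norm x + circle_norm y"
proof -
  obtain s where s: "to_circle s = x" "circle_norm x = \<bar>s\<bar>" by (rule circle_norm_attained)
  obtain t where t: "to_circle t = y" "circle_norm y = \<bar>t\<bar>" by (rule circle_norm_attained)
  have "circle_norm (x + y) \<le> \<bar>s + t\<bar>"
    using circle_norm_le_abs[of "s + t"] s t by (simp add: to_circle_add)
  then show ?thesis using s t by simp
qed

lemma circle_norm_int_scale: "circle_norm (int_scale k x) \<le> \<bar>of_int k\<bar> * circle_norm x"
proof -
  obtain t where t: "to_circle t = x" "circle_norm x = \<bar>t\<bar>" by (rule circle_norm_attained)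
  have "circle_norm (int_scale k x) \<le> \<bar>of_int k * t\<bar>"
    using circle_norm_le_abs[of "of_int k * t"] by (simp add: t(1)[symmetric] int_scale.abs_eq)
  then show ?thesis using t by (simp add: abs_mult)
qed

lemma circle_norm_minus: "circle_norm (- x) = circle_norm x"
proof -
  have *: "circle_norm (- y) \<le> circle_norm y" for y
  proof -
    obtain t where t: "to_circle t = y" "circle_norm y = \<bar>t\<bar>" by (rule circle_norm_attained)
    show ?thesis
      using circle_norm_le_abs[of "- t"] t by (simp add: uminus_circle.abs_eq[symmetric])
  qed
  from *[of x] *[of "- x"] show ?thesis by simp
qed

lemma circle_norm_diff_le: "\<bar>circle_norm x - circle_norm y\<bar> \<le> circle_norm (x - y)"
  using circle_norm_triangle[of "x - y" y] circle_norm_triangle[of "y - x" x]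
    circle_norm_minus[of "x - y"] by simp

lemma circle_norm_sum: "circle_norm (\<Sum>i\<in>I. f i) \<le> (\<Sum>i\<in>I. circle_norm (f i))"
  by (induction I rule: infinite_finite_induct)
    (auto intro: order_trans[OF circle_norm_triangle])

lemma int_scale_diff: "int_scale k (x - y) = int_scale k x - int_scale k y"
  by transfer (simp add: algebra_simps)

lemma int_scale_add: "int_scale k (x + y) = int_scale k x + int_scale k y"
  by transfer (simp add: algebra_simps)

lemma int_scale_0 [simp]: "int_scale k 0 = 0"
  by transfer simp

lemma continuous_on_circle_norm: "continuous_on UNIV circle_norm"
proof -
  have "open (circle_norm -` U)" if "open U" for U
  proof -
    have "to_circle -` (circle_norm -` U) = (\<lambda>x. infdist x \<int>) -` U"
      by (auto simp: circle_norm_to_circle)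
    moreover have "open ((\<lambda>x::real. infdist x \<int>) -` U)"
      using that by (intro open_vimage) (auto intro!: continuous_intros)
    ultimately show ?thesis by (simp add: open_circle_def)
  qed
  then show ?thesis by (simp add: continuous_on_open_vimage)
qed

section \<open>The homomorphism from matrices to column vectors\<close>

lemma mat_int_mult_nth: "mat_int_mult A \<xi> $ m = (\<Sum>n\<in>UNIV. int_scale (\<xi> $ n) (A $ m $ n))"
  by (simp add: mat_int_mult_def)

lemma mat_int_mult_add: "mat_int_mult (A + B) \<xi> = mat_int_mult A \<xi> + mat_int_mult B \<xi>"
  by (simp add: vec_eq_iff mat_int_mult_nth int_scale_add sum.distrib)

lemma mat_int_mult_diff: "mat_int_mult (A - B) \<xi> = mat_int_mult A \<xi> - mat_int_mult B \<xi>"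
  by (simp add: vec_eq_iff mat_int_mult_nth int_scale_diff sum_subtractf)

text \<open>The circle is divisible: all of \<open>B\<close> vanishes except one column
  \<open>k\<close> with \<open>\<xi> $ k\<close> nonzero, and there a representative of each target
  entry is divided by \<open>\<xi> $ k\<close>.\<close>

lemma surj_mat_int_mult:
  fixes \<xi> :: "int ^ 'n" and y :: "circle ^ 'm"
  assumes "\<xi> \<noteq> 0"
  obtains B where "mat_int_mult B \<xi> = y"
proof -
  obtain k where k: "\<xi> $ k \<noteq> 0" using assms by (auto simp: vec_eq_iff)
  define B :: "circle ^ 'n ^ 'm" where
    "B = (\<chi> m n. if n = k then to_circle (rep_circle (y $ m) / of_int (\<xi> $ k)) else 0)"
  have "mat_int_mult B \<xi> $ m = y $ m" for m
  proof -
    have "mat_int_mult B \<xi> $ m = (\<Sum>n\<in>UNIV. if n = k then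
        int_scale (\<xi> $ n) (to_circle (rep_circle (y $ m) / of_int (\<xi> $ k))) else 0)"
      unfolding mat_int_mult_nth by (rule sum.cong) (simp_all add: B_def)
    also have "\<dots> = y $ m"
      using k by (simp add: int_scale.abs_eq to_circle_rep_circle)
    finally show ?thesis .
  qed
  then show ?thesis using that by (auto simp: vec_eq_iff)
qed

text \<open>Addition on the circle need not be shown jointly continuous: the norm is Lipschitz along
  \<open>A \<mapsto> A\<xi>\<close>, and the coordinate differences tend to \<open>0\<close>.\<close>

lemma continuous_on_circle_norm_mat_int_mult:
  "continuous_on UNIV (\<lambda>A::circle^'n^'m. circle_norm (mat_int_mult A \<xi> $ m))"
  unfolding continuous_on_def
proof
  fix A0 :: "circle ^ 'n ^ 'm"
  have tend: "((\<lambda>A. circle_norm (A $ m $ n - A0 $ m $ n)) \<longlongrightarrow> 0) (at A0)" for n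
  proof -
    have "continuous_on UNIV (\<lambda>x. circle_norm (x - A0 $ m $ n))"
      by (rule continuous_on_compose2[OF continuous_on_circle_norm continuous_on_circle_diff]) simp
    then have "continuous_on UNIV (\<lambda>A::circle^'n^'m. circle_norm (A $ m $ n - A0 $ m $ n))"
      by (rule continuous_on_compose2)
        (auto simp: continuous_on_def intro!: tendsto_vec_nth tendsto_ident_at)
    then have "((\<lambda>A. circle_norm (A $ m $ n - A0 $ m $ n)) \<longlongrightarrow>
        circle_norm (A0 $ m $ n - A0 $ m $ n)) (at A0)"
      unfolding continuous_on_def by blast
    then show ?thesis by simp
  qed
  have "((\<lambda>A. \<Sum>n\<in>UNIV. \<bar>of_int (\<xi> $ n)\<bar> * circle_norm (A $ m $ n - A0 $ m $ n)) \<longlongrightarrow>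
      (\<Sum>n\<in>UNIV. \<bar>of_int (\<xi> $ n)\<bar> * 0)) (at A0)"
    by (intro tendsto_sum tendsto_mult tendsto_const tend)
  then have tend0: "((\<lambda>A. \<Sum>n\<in>UNIV. \<bar>of_int (\<xi> $ n)\<bar> * circle_norm (A $ m $ n - A0 $ m $ n)) \<longlongrightarrow> 0) (at A0)"
    by simp
  have le: "norm (circle_norm (mat_int_mult A \<xi> $ m) - circle_norm (mat_int_mult A0 \<xi> $ m))
      \<le> (\<Sum>n\<in>UNIV. \<bar>of_int (\<xi> $ n)\<bar> * circle_norm (A $ m $ n - A0 $ m $ n))" for A
  proof -
    have "norm (circle_norm (mat_int_mult A \<xi> $ m) - circle_norm (mat_int_mult A0 \<xi> $ m))
        \<le> circle_norm (mat_int_mult (A - A0) \<xi> $ m)"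
      using circle_norm_diff_le by (simp add: mat_int_mult_diff)
    also have "\<dots> \<le> (\<Sum>n\<in>UNIV. circle_norm (int_scale (\<xi> $ n) ((A - A0) $ m $ n)))"
      unfolding mat_int_mult_nth by (rule circle_norm_sum)
    also have "\<dots> \<le> (\<Sum>n\<in>UNIV. \<bar>of_int (\<xi> $ n)\<bar> * circle_norm (A $ m $ n - A0 $ m $ n))"
      by (intro sum_mono order_trans[OF circle_norm_int_scale]) simp
    finally show ?thesis .
  qed
  have "((\<lambda>A. circle_norm (mat_int_mult A \<xi> $ m) - circle_norm (mat_int_mult A0 \<xi> $ m))
      \<longlongrightarrow> 0) (at A0)"
    by (rule Lim_null_comparison[OF always_eventually tend0]) (rule allI, rule le)
  then show "((\<lambda>A. circle_norm (mat_int_mult A \<xi> $ m)) \<longlongrightarrow> circle_norm (mat_int_mult A0 \<xi> $ m))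
      (at A0 within UNIV)"
    by (rule LIM_zero_cancel)
qed

section \<open>Averaging over a finite grid\<close>

lemma borel_measurable_circle_norm_mat_int_mult:
  assumes "normalized_haar_measure (\<mu> :: (circle ^ 'n ^ 'm) measure)"
  shows "(\<lambda>A. circle_norm (mat_int_mult A \<xi> $ m)) \<in> borel_measurable \<mu>"
proof -
  have sets: "sets \<mu> = sets borel" using assms by (simp add: normalized_haar_measure_def)
  show ?thesis
    unfolding measurable_cong_sets[OF sets refl]
    by (rule borel_measurable_continuous_onI[OF continuous_on_circle_norm_mat_int_mult])
qed

lemma nn_integral_haar_translate:
  fixes \<mu> :: "(circle ^ 'n ^ 'm) measure"
  assumes haar: "normalized_haar_measure \<mu>" and f: "f \<in> borel_measurable \<mu>"
  shows "(\<integral>\<^sup>+A. f (A + B) \<partial>\<mu>) = (\<integral>\<^sup>+A. f A \<partial>\<mu>)"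
proof -
  have sets: "sets \<mu> = sets borel" using haar by (simp add: normalized_haar_measure_def)
  \<comment> \<open>Translation by \<open>B\<close> is written as a subtraction so that
    \<open>continuous_on_torus_diff\<close> gives its measurability.\<close>
  define T where "T = (\<lambda>A::circle ^ 'n ^ 'm. A - (- B))"
  have "T \<in> borel_measurable borel"
    unfolding T_def by (rule borel_measurable_continuous_onI[OF continuous_on_torus_diff])
  then have T: "T \<in> \<mu> \<rightarrow>\<^sub>M \<mu>"
    unfolding measurable_cong_sets[OF sets sets] by simp
  have "distr \<mu> \<mu> T = \<mu>"
  proof (rule measure_eqI)
    fix S assume "S \<in> sets (distr \<mu> \<mu> T)"
    then have S: "S \<in> sets \<mu>" by simp
    \<comment> \<open>Invariance is formulated for images, so the preimage under a translation is
      rewritten as the image under the opposite one.\<close>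
    have "T -` S = (\<lambda>x. - B + x) ` S"
      by (force simp: T_def image_iff)
    then have "emeasure \<mu> (T -` S) = emeasure \<mu> S"
      using haar S unfolding sets normalized_haar_measure_def by metis
    moreover have "space \<mu> = UNIV" using sets_eq_imp_space_eq[OF sets] by simp
    ultimately show "emeasure (distr \<mu> \<mu> T) S = emeasure \<mu> S"
      using T S by (simp add: emeasure_distr)
  qed simp
  then have "(\<integral>\<^sup>+A. f A \<partial>\<mu>) = (\<integral>\<^sup>+A. f (T A) \<partial>\<mu>)"
    using nn_integral_distr[OF T, of f] f by simp
  then show ?thesis by (simp add: T_def)
qed

text \<open>Every grid shift of \<open>A\<xi>\<close> comes from a translation of \<open>A\<close>
  and leaves the integral unchanged, so the integral equals its average over all
  \<open>q ^ M\<close> shifts. The sum over the product grid factors into one-dimensional grid sums,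
  which does the work of independence of the coordinates.\<close>

lemma nn_integral_prod_le_grid:
  fixes \<mu> :: "(circle ^ 'n ^ 'm) measure" and w :: "'m \<Rightarrow> circle \<Rightarrow> ennreal"
  assumes haar: "normalized_haar_measure \<mu>" and \<xi>: "\<xi> \<noteq> 0" and q: "q > 0"
    and w: "\<And>m. (\<lambda>A. w m (mat_int_mult A \<xi> $ m)) \<in> borel_measurable \<mu>"
    and grid: "\<And>m x. (\<Sum>j<q. w m (x + to_circle (real j / real q))) \<le> of_nat q * K m"
  shows "(\<integral>\<^sup>+A. (\<Prod>m\<in>UNIV. w m (mat_int_mult A \<xi> $ m)) \<partial>\<mu>) \<le> (\<Prod>m\<in>UNIV. K m)"
proof -
  define f where "f = (\<lambda>A. \<Prod>m\<in>UNIV. w m (mat_int_mult A \<xi> $ m))"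
  define J where "J = PiE (UNIV :: 'm set) (\<lambda>_. {..<q})"
  define t where "t = (\<lambda>j::'m \<Rightarrow> nat. \<chi> m. to_circle (real (j m) / real q))"
  have f: "f \<in> borel_measurable \<mu>"
    unfolding f_def by (intro borel_measurable_prod_ennreal w)
  have sets: "sets \<mu> = sets borel" using haar by (simp add: normalized_haar_measure_def)
  have shift: "(\<integral>\<^sup>+A. (\<Prod>m\<in>UNIV. w m (mat_int_mult A \<xi> $ m + t j $ m)) \<partial>\<mu>) = (\<integral>\<^sup>+A. f A \<partial>\<mu>)"
      and meas: "(\<lambda>A. \<Prod>m\<in>UNIV. w m (mat_int_mult A \<xi> $ m + t j $ m)) \<in> borel_measurable \<mu>" for j
  proof -
    obtain B where B: "mat_int_mult B \<xi> = t j" by (rule surj_mat_int_mult[OF \<xi>])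
    have eq: "(\<lambda>A. \<Prod>m\<in>UNIV. w m (mat_int_mult A \<xi> $ m + t j $ m)) = (\<lambda>A. f (A + B))"
      by (simp add: f_def mat_int_mult_add B)
    show "(\<integral>\<^sup>+A. (\<Prod>m\<in>UNIV. w m (mat_int_mult A \<xi> $ m + t j $ m)) \<partial>\<mu>) = (\<integral>\<^sup>+A. f A \<partial>\<mu>)"
      using nn_integral_haar_translate[OF haar f, of B] by (simp add: eq)
    have "(\<lambda>A. A - (- B)) \<in> borel_measurable borel"
      by (rule borel_measurable_continuous_onI[OF continuous_on_torus_diff])
    then have "(\<lambda>A. A + B) \<in> \<mu> \<rightarrow>\<^sub>M \<mu>"
      unfolding measurable_cong_sets[OF sets sets] by simp
    from measurable_compose[OF this f] show
      "(\<lambda>A. \<Prod>m\<in>UNIV. w m (mat_int_mult A \<xi> $ m + t j $ m)) \<in> borel_measurable \<mu>"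
      by (simp add: eq)
  qed
  have card: "card J = q ^ CARD('m)"
    by (simp add: J_def card_PiE)
  have "of_nat q ^ CARD('m) * (\<integral>\<^sup>+A. f A \<partial>\<mu>) = (\<Sum>j\<in>J. \<integral>\<^sup>+A. f A \<partial>\<mu>)"
    by (simp add: card)
  also have "\<dots> = (\<Sum>j\<in>J. \<integral>\<^sup>+A. (\<Prod>m\<in>UNIV. w m (mat_int_mult A \<xi> $ m + t j $ m)) \<partial>\<mu>)"
    by (simp add: shift)
  also have "\<dots> = (\<integral>\<^sup>+A. (\<Sum>j\<in>J. \<Prod>m\<in>UNIV. w m (mat_int_mult A \<xi> $ m + t j $ m)) \<partial>\<mu>)"
    by (rule nn_integral_sum[symmetric]) (rule meas)
  \<comment> \<open>Distributivity: choosing one index per coordinate amounts to choosing an element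
    of \<open>J\<close>.\<close>
  also have "\<dots> = (\<integral>\<^sup>+A. (\<Prod>m\<in>UNIV. \<Sum>j<q. w m (mat_int_mult A \<xi> $ m + to_circle (real j / real q))) \<partial>\<mu>)"
    by (simp add: J_def t_def prod_sum_PiE)
  also have "\<dots> \<le> (\<integral>\<^sup>+A. (\<Prod>m\<in>UNIV. of_nat q * K m) \<partial>\<mu>)"
    by (intro nn_integral_mono prod_mono_ennreal grid)
  also have "\<dots> = of_nat q ^ CARD('m) * (\<Prod>m\<in>UNIV. K m)"
    using haar sets_eq_imp_space_eq[OF sets]
    by (simp add: normalized_haar_measure_def prod.distrib)
  finally show ?thesis
    unfolding f_def using q
    by (subst (asm) ennreal_mult_le_mult_iff) (auto simp: power_eq_top_ennreal)
qed

section \<open>Grid sums in one coordinate\<close>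

text \<open>The grid is a finite subgroup of the circle, so the sum depends only on the coset of
  \<open>x\<close>, and each coset has a representative in [0, 1/q).\<close>

lemma grid_sum_shift:
  fixes p :: "circle \<Rightarrow> 'a::comm_monoid_add"
  assumes q: "q > 0"
  obtains r where "0 \<le> r" "r < 1 / real q"
    "(\<Sum>j<q. p (x + to_circle (real j / real q))) = (\<Sum>j<q. p (to_circle (r + real j / real q)))"
proof -
  define S where "S = (\<lambda>y. \<Sum>j<q. p (to_circle (y + real j / real q)))"
  have step: "S (y + 1 / real q) = S y" for y
  proof -
    obtain q' where q': "q = Suc q'" using q by (cases q) auto
    \<comment> \<open>A shift by one grid step permutes the terms cyclically: the term that leaves
      at index \<open>q\<close> is the one missing at index 0.\<close>
    have last: "to_circle (y + 1) = to_circle y"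
      by (simp add: circle.abs_eq_iff)
    have "S (y + 1 / real q) = (\<Sum>j<q. p (to_circle (y + real (Suc j) / real q)))"
      by (simp add: S_def add_divide_distrib add_ac)
    also have "\<dots> = (\<Sum>j<q'. p (to_circle (y + real (Suc j) / real q))) + p (to_circle (y + 1))"
      unfolding q' by (simp del: of_nat_Suc)
    also have "\<dots> = S y"
      unfolding S_def last q' sum.lessThan_Suc_shift by (simp add: add.commute)
    finally show ?thesis .
  qed
  have steps: "S (y + real k / real q) = S y" for y k
  proof (induction k)
    case (Suc k)
    then show ?case using step[of "y + real k / real q"] by (simp add: add_divide_distrib add_ac)
  qed simp
  define t where "t = frac (rep_circle x)"
  have "to_circle t = to_circle (rep_circle x)"
    by (simp add: t_def circle.abs_eq_iff frac_def)
  then have t: "to_circle t = x" "t \<ge> 0"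
    by (simp_all add: to_circle_rep_circle t_def)
  \<comment> \<open>\<open>k\<close> counts the whole grid steps contained in \<open>t\<close>, and
    \<open>r\<close> is what remains.\<close>
  define k where "k = nat \<lfloor>real q * t\<rfloor>"
  define r where "r = t - real k / real q"
  have k: "real k \<le> real q * t" "real q * t < real k + 1"
    using t(2) by (auto simp: k_def of_nat_nat)
  show ?thesis
  proof
    show "0 \<le> r"
      using k q by (simp add: r_def pos_divide_le_eq mult.commute)
    have "r = (real q * t - real k) / real q"
      using q by (simp add: r_def diff_divide_distrib)
    then show "r < 1 / real q"
      using k q by (simp add: divide_strict_right_mono)
    show "(\<Sum>j<q. p (x + to_circle (real j / real q))) = (\<Sum>j<q. p (to_circle (r + real j / real q)))"
      using steps[of r k] by (simp add: S_def t(1)[symmetric] to_circle_add[symmetric] r_def)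
  qed
qed

text \<open>Any representative differs from \<open>t\<close> by an integer that is at least 0 or at
  most -1, hence is at least \<open>t\<close> or at most \<open>t - 1\<close>.\<close>

lemma circle_norm_ge_min:
  assumes "0 \<le> t" "t \<le> 1"
  shows "min t (1 - t) \<le> circle_norm (to_circle t)"
proof -
  obtain s where s: "to_circle s = to_circle t" "circle_norm (to_circle t) = \<bar>s\<bar>"
    by (rule circle_norm_attained)
  from s(1) obtain k where "s - t = of_int k" by (auto simp: circle.abs_eq_iff elim: Ints_cases)
  moreover have "k \<ge> 0 \<or> k \<le> -1" by linarith
  then have "real_of_int k \<ge> 0 \<or> real_of_int k \<le> -1" by linarith
  ultimately have "s \<ge> t \<or> s \<le> t - 1" by auto
  then show ?thesis using s(2) assms by auto
qed

text \<open>The point lies between j/q and (j+1)/q. Its distance to 1 is therefore controlled by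
  \<open>q - 1 - j\<close>, and the bound is symmetric under reversal of the indices.\<close>

lemma circle_norm_grid_ge:
  assumes "q > 0" "0 \<le> r" "r < 1 / real q" "j < q"
  shows "real (min j (q - 1 - j)) / real q \<le> circle_norm (to_circle (r + real j / real q))"
proof -
  have *: "r * real q < 1" using assms by (simp add: field_simps)
  have 1: "real j / real q \<le> r + real j / real q" using assms by simp
  have 2: "real (q - 1 - j) / real q \<le> 1 - (r + real j / real q)"
    using assms * by (simp add: field_simps of_nat_diff)
  have "real (min j (q - 1 - j)) / real q \<le> min (real j / real q) (real (q - 1 - j) / real q)"
    by (auto intro: divide_right_mono)
  also have "\<dots> \<le> min (r + real j / real q) (1 - (r + real j / real q))"
    using 1 2 by linarith
  also have "\<dots> \<le> circle_norm (to_circle (r + real j / real q))"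
    using order_trans[OF _ 2, of 0] assms by (intro circle_norm_ge_min) auto
  finally show ?thesis .
qed

text \<open>One factor of \<open>F\<close>, cut off at height q/2. It is real-valued, so finite also
  where the factor of \<open>F\<close> is infinite.\<close>

definition circle_trunc :: "nat \<Rightarrow> circle \<Rightarrow> real" where
  "circle_trunc q x = 1 / (2 * max (circle_norm x) (1 / real q))"

lemma circle_trunc_nonneg: "0 \<le> circle_trunc q x"
  by (simp add: circle_trunc_def le_max_iff_disj)

text \<open>The sequence \<open>harm n - ln n\<close> decreases from its value 1 at
  \<open>n = 1\<close>.\<close>

lemma harm_le_1_plus_ln:
  assumes "n > 0"
  shows "harm n \<le> 1 + ln (real n)"
  using euler_mascheroni_sequence_decreasing[of 1 n] assms by (simp add: harm_def)

lemma sum_inverse_max_1_le: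
  assumes "q > 0"
  shows "(\<Sum>j<q. 1 / real (max j 1)) \<le> 2 + ln (real q)"
proof -
  obtain q' where q': "q = Suc q'" using assms by (cases q) auto
  have "(\<Sum>j<q. 1 / real (max j 1)) = 1 + harm q'"
    unfolding q' harm_altdef sum.lessThan_Suc_shift by (simp add: inverse_eq_divide)
  also have "harm q' \<le> (harm q :: real)" unfolding q' by (intro harm_mono) simp
  also have "\<dots> \<le> 1 + ln (real q)" using assms by (rule harm_le_1_plus_ln)
  finally show ?thesis by simp
qed

text \<open>A grid point about d/q away from 0 contributes at most q/(2d), and each \<open>d\<close>
  is met at most once from either end of the unit interval. This leaves two harmonic sums, each with
  weight q/2.\<close>

lemma sum_circle_trunc_grid_le:
  assumes q: "q > 0"
  shows "(\<Sum>j<q. circle_trunc q (x + to_circle (real j / real q))) \<le> real q * (2 + ln (real q))"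
proof -
  obtain r where r: "0 \<le> r" "r < 1 / real q"
    and eq: "(\<Sum>j<q. circle_trunc q (x + to_circle (real j / real q))) =
      (\<Sum>j<q. circle_trunc q (to_circle (r + real j / real q)))"
    by (rule grid_sum_shift[OF q])
  define a where "a = (\<lambda>j. 1 / real (max j 1))"
  have le: "circle_trunc q (to_circle (r + real j / real q)) \<le> real q / 2 * (a j + a (q - Suc j))"
    if "j < q" for j
  proof -
    \<comment> \<open>The outer \<open>max\<close> with 1 is the cutoff 1/q, measured in grid
      steps.\<close>
    define d where "d = real (max (min j (q - 1 - j)) 1)"
    have d: "d \<ge> 1" by (simp add: d_def)
    have "d / real q = max (real (min j (q - 1 - j)) / real q) (1 / real q)"
      using q by (auto simp: d_def max_def field_simps)
    also have "\<dots> \<le> max (circle_norm (to_circle (r + real j / real q))) (1 / real q)"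
      using circle_norm_grid_ge[OF q r that] by linarith
    finally have "circle_trunc q (to_circle (r + real j / real q)) \<le> 1 / (2 * (d / real q))"
      unfolding circle_trunc_def using d q by (intro divide_left_mono mult_pos_pos) (auto simp: less_max_iff_disj)
    also have "\<dots> = real q / 2 * (1 / d)" by simp
    \<comment> \<open>The reciprocal of a minimum is one of the two reciprocals; bounding it by
      their sum separates the two ends, whose sums agree after reversal.\<close>
    also have "1 / d \<le> a j + a (q - Suc j)"
      unfolding d_def a_def min_def by auto
    finally show ?thesis using q by simp
  qed
  have "(\<Sum>j<q. circle_trunc q (to_circle (r + real j / real q)))
      \<le> (\<Sum>j<q. real q / 2 * (a j + a (q - Suc j)))"
    by (intro sum_mono le) simp
  also have "\<dots> = real q / 2 * ((\<Sum>j<q. a j) + (\<Sum>j<q. a (q - Suc j)))"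
    by (simp only: sum_distrib_left[symmetric] sum.distrib)
  also have "\<dots> = real q * (\<Sum>j<q. a j)"
    using sum.nat_diff_reindex[of a q] by simp
  also have "\<dots> \<le> real q * (2 + ln (real q))"
    unfolding a_def by (intro mult_left_mono sum_inverse_max_1_le q) simp
  finally show ?thesis using eq by simp
qed

text \<open>Only the two extreme indices 0 and \<open>q - 1\<close> can lie closer than 1/q to an
  integer.\<close>

lemma sum_indicator_grid_le:
  assumes q: "q > 0"
  shows "(\<Sum>j<q. indicator {y. circle_norm y < 1 / real q} (x + to_circle (real j / real q)))
    \<le> (2 :: ennreal)"
proof -
  let ?U = "{y. circle_norm y < 1 / real q}"
  obtain r where r: "0 \<le> r" "r < 1 / real q"
    and eq: "(\<Sum>j<q. indicator ?U (x + to_circle (real j / real q))) =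
      (\<Sum>j<q. indicator ?U (to_circle (r + real j / real q)) :: ennreal)"
    by (rule grid_sum_shift[OF q])
  have "(\<Sum>j<q. indicator ?U (to_circle (r + real j / real q)) :: ennreal)
      \<le> (\<Sum>j<q. (if j = 0 then 1 else 0) + (if j = q - 1 then 1 else 0))"
  proof (rule sum_mono)
    fix j assume "j \<in> {..<q}"
    then have j: "j < q" by simp
    have False if "j \<noteq> 0" "j \<noteq> q - 1" "circle_norm (to_circle (r + real j / real q)) < 1 / real q"
    proof -
      have "1 \<le> real (min j (q - 1 - j))" using that j by auto
      then have "1 / real q \<le> real (min j (q - 1 - j)) / real q"
        by (intro divide_right_mono) auto
      with circle_norm_grid_ge[OF q r j] that show False by linarith
    qed
    then show "(indicator ?U (to_circle (r + real j / real q)) :: ennreal)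
        \<le> (if j = 0 then 1 else 0) + (if j = q - 1 then 1 else 0)"
      by (auto simp: indicator_def)
  qed
  also have "\<dots> = 2"
    using q by (simp add: sum.distrib)
  finally show ?thesis using eq by simp
qed

section \<open>Integral and measure estimates for a single nonzero integer vector\<close>

text \<open>This is the gain from truncating: each coordinate costs a logarithm of \<open>q\<close>,
  whereas the integral of \<open>F\<close> itself diverges.\<close>

lemma nn_integral_circle_trunc_le:
  fixes \<mu> :: "(circle ^ 'n ^ 'm) measure"
  assumes haar: "normalized_haar_measure \<mu>" and "\<xi> \<noteq> 0" and q: "q > 0"
  shows "(\<integral>\<^sup>+A. (\<Prod>m\<in>UNIV. ennreal (circle_trunc q (mat_int_mult A \<xi> $ m))) \<partial>\<mu>)
    \<le> ennreal ((2 + ln (real q)) ^ CARD('m))"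
proof -
  note [measurable] = borel_measurable_circle_norm_mat_int_mult[OF haar]
  have ln: "0 \<le> ln (real q)" using q by simp
  have "(\<Sum>j<q. ennreal (circle_trunc q (x + to_circle (real j / real q))))
      \<le> of_nat q * ennreal (2 + ln (real q))" for x
  proof -
    have "(\<Sum>j<q. ennreal (circle_trunc q (x + to_circle (real j / real q))))
        \<le> ennreal (real q * (2 + ln (real q)))"
      by (simp add: sum_ennreal circle_trunc_nonneg ennreal_leI sum_circle_trunc_grid_le[OF q])
    then show ?thesis using ln by (simp add: ennreal_mult ennreal_of_nat_eq_real_of_nat)
  qed
  moreover have "(\<lambda>A. ennreal (circle_trunc q (mat_int_mult A \<xi> $ m))) \<in> borel_measurable \<mu>" for m
    unfolding circle_trunc_def by measurable
  ultimately have "(\<integral>\<^sup>+A. (\<Prod>m\<in>UNIV. ennreal (circle_trunc q (mat_int_mult A \<xi> $ m))) \<partial>\<mu>)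
      \<le> (\<Prod>m\<in>(UNIV::'m set). ennreal (2 + ln (real q)))"
    using assms by (intro nn_integral_prod_le_grid[where q = q])
  then show ?thesis using ln by (simp add: ennreal_power del: ennreal_plus)
qed

lemma emeasure_circle_norm_less_le:
  fixes \<mu> :: "(circle ^ 'n ^ 'm) measure"
  assumes haar: "normalized_haar_measure \<mu>" and "\<xi> \<noteq> 0" and q: "q > 0"
  shows "emeasure \<mu> {A \<in> space \<mu>. circle_norm (mat_int_mult A \<xi> $ k) < 1 / real q} \<le> ennreal (2 / real q)"
proof -
  note [measurable] = borel_measurable_circle_norm_mat_int_mult[OF haar]
  \<comment> \<open>A constant weight 1 off coordinate \<open>k\<close> turns the product into a
    single indicator. Its grid sum is at most 2, which is q times 2/q.\<close>
  define w :: "'m \<Rightarrow> circle \<Rightarrow> ennreal" where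
    "w = (\<lambda>m. if m = k then indicator {y. circle_norm y < 1 / real q} else (\<lambda>_. 1))"
  define K :: "'m \<Rightarrow> ennreal" where "K = (\<lambda>m. if m = k then ennreal (2 / real q) else 1)"
  have "(\<lambda>A. indicator {y. circle_norm y < 1 / real q} (mat_int_mult A \<xi> $ m) :: ennreal)
      = indicator {A. circle_norm (mat_int_mult A \<xi> $ m) < 1 / real q}" for m
    by (auto simp: indicator_def)
  then have "(\<lambda>A. w m (mat_int_mult A \<xi> $ m)) \<in> borel_measurable \<mu>" for m
    unfolding w_def by (cases "m = k") simp_all
  moreover have "of_nat q * ennreal (2 / real q) = 2"
    using q by (simp add: ennreal_of_nat_eq_real_of_nat ennreal_mult[symmetric])
  then have "(\<Sum>j<q. w m (x + to_circle (real j / real q))) \<le> of_nat q * K m" for m x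
    using sum_indicator_grid_le[OF q] by (simp add: w_def K_def)
  ultimately have "(\<integral>\<^sup>+A. (\<Prod>m\<in>UNIV. w m (mat_int_mult A \<xi> $ m)) \<partial>\<mu>) \<le> (\<Prod>m\<in>UNIV. K m)"
    using assms by (intro nn_integral_prod_le_grid[where q = q])
  moreover have "(\<Prod>m\<in>UNIV. w m (mat_int_mult A \<xi> $ m))
      = indicator {A. circle_norm (mat_int_mult A \<xi> $ k) < 1 / real q} A" for A
  proof -
    have "(\<Prod>m\<in>UNIV. w m (mat_int_mult A \<xi> $ m)) = (\<Prod>m\<in>UNIV. if m = k then
        indicator {y. circle_norm y < 1 / real q} (mat_int_mult A \<xi> $ m) else 1)"
      by (intro prod.cong) (auto simp: w_def)
    then show ?thesis by (simp add: indicator_def)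
  qed
  moreover have "(\<Prod>m\<in>UNIV. K m) = ennreal (2 / real q)" by (simp add: K_def)
  moreover have "(\<integral>\<^sup>+A. indicator {A. circle_norm (mat_int_mult A \<xi> $ k) < 1 / real q} A \<partial>\<mu>)
      = (\<integral>\<^sup>+A. indicator {A \<in> space \<mu>. circle_norm (mat_int_mult A \<xi> $ k) < 1 / real q} A \<partial>\<mu>)"
    by (intro nn_integral_cong) (auto simp: indicator_def)
  ultimately show ?thesis by simp
qed

text \<open>Each zero set has measure at most 2/(n+1) for every \<open>n\<close>, and there are
  countably many integer vectors. The result makes \<open>F\<close> finite at all relevant points,
  which handles the finitely many exceptional indices.\<close>

lemma AE_circle_norm_pos:
  fixes \<mu> :: "(circle ^ 'n ^ 'm) measure"
  assumes haar: "normalized_haar_measure \<mu>"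
  shows "AE A in \<mu>. \<forall>\<xi>. \<xi> \<noteq> 0 \<longrightarrow> (\<forall>m. circle_norm (mat_int_mult A \<xi> $ m) > 0)"
proof -
  note [measurable] = borel_measurable_circle_norm_mat_int_mult[OF haar]
  have "AE A in \<mu>. circle_norm (mat_int_mult A \<xi> $ m) > 0" if \<xi>: "\<xi> \<noteq> 0" for \<xi> m
  proof -
    let ?Z = "{A \<in> space \<mu>. circle_norm (mat_int_mult A \<xi> $ m) \<le> 0}"
    have le: "emeasure \<mu> ?Z \<le> ennreal (2 / real (Suc n))" for n
    proof -
      have "emeasure \<mu> ?Z
          \<le> emeasure \<mu> {A \<in> space \<mu>. circle_norm (mat_int_mult A \<xi> $ m) < 1 / real (Suc n)}"
        by (intro emeasure_mono) (auto intro: le_less_trans)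
      also have "\<dots> \<le> ennreal (2 / real (Suc n))"
        by (rule emeasure_circle_norm_less_le[OF haar \<xi>]) simp
      finally show ?thesis .
    qed
    have "(\<lambda>n. ennreal (2 / real (Suc n))) \<longlonglongrightarrow> ennreal 0"
      by (intro tendsto_ennrealI LIMSEQ_Suc lim_const_over_n)
    from LIMSEQ_le_const[OF this, of "emeasure \<mu> ?Z"] have "emeasure \<mu> ?Z = 0"
      using le by auto
    then show ?thesis by (intro AE_I[of _ _ ?Z]) (auto simp: not_less)
  qed
  moreover have "countable (UNIV :: (int ^ 'n) set)"
    by (rule countableI_type)
  ultimately show ?thesis
    by (simp add: AE_all_countable)
qed

lemma F_eq_prod_circle_trunc:
  assumes "q > 0" "\<And>m. 1 / real q \<le> circle_norm (x $ m)"
  shows "F x = (\<Prod>m\<in>UNIV. ennreal (circle_trunc q (x $ m)))"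
proof -
  have "inverse (ennreal (2 * circle_norm (x $ m))) = ennreal (circle_trunc q (x $ m))" for m
  proof -
    have "0 < 1 / real q" using assms(1) by simp
    then have "0 < circle_norm (x $ m)" using assms(2)[of m] by linarith
    then show ?thesis
      using assms(2)[of m] by (simp add: circle_trunc_def inverse_ennreal inverse_eq_divide max_absorb1)
  qed
  then show ?thesis by (simp add: F_def)
qed

lemma F_less_top:
  assumes "\<And>m. circle_norm (x $ m) > 0"
  shows "F x < top"
proof -
  have "F x = ennreal (\<Prod>m\<in>UNIV. inverse (2 * circle_norm (x $ m)))"
    unfolding F_def using assms by (simp add: inverse_ennreal prod_ennreal)
  then show ?thesis by simp
qed

section \<open>The majorant\<close>

lemma ln_3_ge_1: "1 \<le> ln (3::real)"
  using exp_le by (simp add: ln_ge_iff)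

lemma ln_27: "ln (27::real) = 3 * ln 3"
  using ln_realpow[of "3::real" 3] by simp

text \<open>The right side of the theorem without its constant, at a real argument so that multiples
  of a cardinality can be inserted.\<close>

definition majorant :: "nat \<Rightarrow> real \<Rightarrow> real \<Rightarrow> real" where
  "majorant M \<eta> x = x * ln (3 * x) ^ (M + 1) * ln (ln (27 * x)) powr (1 + \<eta>)"

text \<open>This explains the constants 3 and 27: \<open>ln 3\<close> is at least 1, and
  \<open>ln 27 = 3 * ln 3\<close> is at least 3, so its logarithm is again at least 1.\<close>

lemma majorant_factors_ge_1:
  fixes x :: real
  assumes "1 \<le> x"
  shows "1 \<le> ln (3 * x)" "1 \<le> ln (ln (27 * x))" "3 \<le> ln (27 * x)"
proof -
  have x: "0 \<le> ln x" using assms by simp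
  have "ln (3 * x) = ln 3 + ln x" using assms by (simp add: ln_mult)
  then show "1 \<le> ln (3 * x)" using x ln_3_ge_1 by linarith
  have "ln (27 * x) = 3 * ln 3 + ln x" using assms by (simp add: ln_mult ln_27)
  then show 3: "3 \<le> ln (27 * x)" using x ln_3_ge_1 by linarith
  have "ln 3 \<le> ln (ln (27 * x))" using 3 by (subst ln_le_cancel_iff) auto
  then show "1 \<le> ln (ln (27 * x))" using ln_3_ge_1 by linarith
qed

lemma majorant_pos: "1 \<le> x \<Longrightarrow> 0 < majorant M \<eta> x"
  using majorant_factors_ge_1[of x] by (auto simp: majorant_def)

lemma majorant_mono:
  assumes "1 \<le> x" "x \<le> y" "0 < \<eta>"
  shows "majorant M \<eta> x \<le> majorant M \<eta> y"
proof -
  note x = majorant_factors_ge_1[OF assms(1)]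
  have "ln (3 * x) \<le> ln (3 * y)" "ln (27 * x) \<le> ln (27 * y)" using assms by auto
  moreover from this have "ln (ln (27 * x)) \<le> ln (ln (27 * y))" using x by auto
  ultimately show ?thesis
    unfolding majorant_def using assms x
    by (intro mult_mono power_mono powr_mono2) auto
qed

text \<open>Since every logarithmic factor \<open>u\<close> is at least 1, an added constant becomes
  a multiple: \<open>ln C + u \<le> (1 + ln C) * u\<close>. Applied to the logarithm this gives
  \<open>a\<close>, and to the iterated logarithm \<open>b\<close>.\<close>

lemma majorant_mult_le:
  assumes "1 \<le> C" "0 < \<eta>"
  obtains K where "0 < K" "\<And>x. 1 \<le> x \<Longrightarrow> majorant M \<eta> (C * x) \<le> K * majorant M \<eta> x"
proof
  define a where "a = 1 + ln C"
  define b where "b = 1 + ln a"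
  have ab: "1 \<le> a" "1 \<le> b" using assms by (auto simp: a_def b_def)
  show "0 < C * a ^ (M + 1) * b powr (1 + \<eta>)" using ab assms by auto
  fix x :: real assume x: "1 \<le> x"
  have Cx: "1 \<le> C * x" using x assms mult_mono[of 1 C 1 x] by auto
  have scale: "ln (c * (C * x)) \<le> a * ln (c * x)" if "1 \<le> ln (c * x)" "0 < c" for c
  proof -
    have "ln (c * (C * x)) = ln C + ln (c * x)"
      using x assms that by (simp add: ln_mult)
    also have "ln C \<le> ln C * ln (c * x)"
      using that assms by (simp add: mult_le_cancel_left1)
    finally show ?thesis by (simp add: a_def algebra_simps)
  qed
  note f = majorant_factors_ge_1[OF x] majorant_factors_ge_1[OF Cx]
  have f0: "0 \<le> ln (3 * (C * x))" using f by linarith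
  have 1: "ln (3 * (C * x)) \<le> a * ln (3 * x)" using f by (intro scale) auto
  have "ln (27 * (C * x)) \<le> a * ln (27 * x)" using f by (intro scale) auto
  then have "ln (ln (27 * (C * x))) \<le> ln (a * ln (27 * x))"
    using f ab by (subst ln_le_cancel_iff) auto
  also have "\<dots> = ln a + ln (ln (27 * x))"
    using f ab by (simp add: ln_mult)
  also have "ln a \<le> ln a * ln (ln (27 * x))"
    using f ab by (simp add: mult_le_cancel_left1)
  finally have 2: "ln (ln (27 * (C * x))) \<le> b * ln (ln (27 * x))" by (simp add: b_def algebra_simps)
  have "majorant M \<eta> (C * x)
      \<le> C * x * (a * ln (3 * x)) ^ (M + 1) * (b * ln (ln (27 * x))) powr (1 + \<eta>)"
    unfolding majorant_def using assms x ab f f0 1 2 zero_le_power[OF f0, of "M + 1"]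
    by (intro mult_mono power_mono powr_mono2) (simp_all del: power_add power_Suc ln_ge_zero_iff)
  also have "\<dots> = C * a ^ (M + 1) * b powr (1 + \<eta>) * majorant M \<eta> x"
    unfolding majorant_def power_mult_distrib using ab f by (simp add: powr_mult mult_ac)
  finally show "majorant M \<eta> (C * x) \<le> C * a ^ (M + 1) * b powr (1 + \<eta>) * majorant M \<eta> x" .
qed

section \<open>Convergence of the comparison series\<close>

text \<open>Concavity of \<open>ln\<close> between 1 and \<open>a\<close>, with weight
  \<open>min L 1\<close> on \<open>a\<close>; the endpoint 1 contributes nothing.\<close>

lemma ln_3_plus_mult_ge:
  fixes L a :: real
  assumes "0 < L" "1 \<le> a"
  shows "min L 1 * ln a \<le> ln (3 + L * a)"
proof -
  define t where "t = min L 1"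
  have t: "0 < t" "t \<le> 1" "t \<le> L" using assms by (auto simp: t_def)
  have "t * ln a \<le> ln ((1 - t) * 1 + t * a)"
    using concave_onD[OF ln_concave, of t 1 a] t assms by simp
  also have "\<dots> \<le> ln (3 + L * a)"
  proof -
    have "0 < (1 - t) * 1 + t * a" using t assms by (simp add: add_nonneg_pos)
    moreover have "t * a \<le> L * a" using t assms by (intro mult_right_mono) auto
    ultimately show ?thesis using t by simp
  qed
  finally show ?thesis by (simp add: t_def)
qed

text \<open>Cauchy condensation replaces n by a power of 2. The logarithm then grows linearly in the
  exponent, leaving a p-series with exponent \<open>1 + \<eta>\<close>.\<close>

lemma summable_inverse_mult_ln_powr:
  assumes L: "0 < L" and \<eta>: "0 < \<eta>"
  shows "summable (\<lambda>n. 1 / (real n * ln (3 + L * real n) powr (1 + \<eta>)))"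
proof (subst condensation_test)
  have pos: "0 < ln (3 + L * real n)" for n
    using L by (intro ln_gt_zero) (simp add: add_pos_nonneg)
  show "1 / (real (Suc m) * ln (3 + L * real (Suc m)) powr (1 + \<eta>))
      \<le> 1 / (real m * ln (3 + L * real m) powr (1 + \<eta>))" if "0 < m" for m
  proof -
    have "ln (3 + L * real m) \<le> ln (3 + L * real (Suc m))"
      using L by (subst ln_le_cancel_iff) (auto simp: add_pos_nonneg)
    then show ?thesis
      using that pos[of m] pos[of "Suc m"] \<eta>
      by (intro divide_left_mono mult_mono powr_mono2 mult_pos_pos) auto
  qed
  show "0 \<le> 1 / (real n * ln (3 + L * real n) powr (1 + \<eta>))" for n by simp
  define \<kappa> where "\<kappa> = min L 1 * ln 2"
  have \<kappa>: "0 < \<kappa>" using L by (simp add: \<kappa>_def)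
  have "summable (\<lambda>n. \<kappa> powr - (1 + \<eta>) * real n powr - (1 + \<eta>))"
    using \<eta> by (intro summable_mult) (simp add: summable_real_powr_iff)
  then show "summable (\<lambda>n. 2 ^ n * (1 / (real (2 ^ n) * ln (3 + L * real (2 ^ n)) powr (1 + \<eta>))))"
  \<comment> \<open>The comparison starts at 1: for \<open>n = 0\<close> the majorizing term is 0,
    because \<open>0 powr\<close> anything is 0.\<close>
  proof (rule summable_comparison_test'[where N = 1])
    fix n :: nat assume n: "1 \<le> n"
    have "\<kappa> * real n \<le> ln (3 + L * 2 ^ n)"
      using ln_3_plus_mult_ge[OF L, of "2 ^ n"] by (simp add: \<kappa>_def ln_realpow mult_ac)
    then have "ln (3 + L * 2 ^ n) powr - (1 + \<eta>) \<le> (\<kappa> * real n) powr - (1 + \<eta>)"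
      using \<kappa> n \<eta> by (intro powr_mono2') auto
    then show "norm (2 ^ n * (1 / (real (2 ^ n) * ln (3 + L * real (2 ^ n)) powr (1 + \<eta>))))
        \<le> \<kappa> powr - (1 + \<eta>) * real n powr - (1 + \<eta>)"
      using \<kappa> by (simp add: powr_mult powr_minus_divide del: minus_add_distrib)
  qed
qed

text \<open>The numerator will be the integral bound of a truncated sum. It cancels \<open>M\<close>
  of the \<open>M + 1\<close> logarithms; exponential growth of \<open>y\<close> makes the last one
  at least linear in \<open>l\<close>, and the iterated one at least logarithmic.\<close>

lemma summable_majorant_ratio:
  fixes y :: "nat \<Rightarrow> real"
  assumes C: "1 < C" and \<eta>: "0 < \<eta>" and y: "\<And>l. C ^ Suc l \<le> y l"
  shows "summable (\<lambda>l. y l * (2 * ln (3 * y l)) ^ M / majorant M \<eta> (y l))"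
proof -
  define L where "L = ln C"
  have L: "0 < L" using C by (simp add: L_def)
  have "summable (\<lambda>n. 1 / (real (Suc n) * ln (3 + L * real (Suc n)) powr (1 + \<eta>)))"
    by (subst summable_Suc_iff) (rule summable_inverse_mult_ln_powr[OF L \<eta>])
  then have "summable (\<lambda>n. 2 ^ M / L * (1 / (real (Suc n) * ln (3 + L * real (Suc n)) powr (1 + \<eta>))))"
    by (rule summable_mult)
  then show ?thesis
  proof (rule summable_comparison_test'[where N = 0])
    fix l :: nat
    have "1 \<le> C ^ Suc l" using C by (intro one_le_power) simp
    then have y1: "1 \<le> y l" using y[of l] by linarith
    note f = majorant_factors_ge_1[OF y1]
    have "ln (C ^ Suc l) \<le> ln (y l)" using y[of l] C y1 by (subst ln_le_cancel_iff) auto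
    then have ln_y: "L * real (Suc l) \<le> ln (y l)"
      using C by (simp only: ln_realpow L_def mult.commute)
    have 1: "L * real (Suc l) \<le> ln (3 * y l)"
      using ln_y ln_3_ge_1 y1 by (simp add: ln_mult)
    have "3 + L * real (Suc l) \<le> ln (27 * y l)"
      using ln_y ln_3_ge_1 y1 by (simp add: ln_mult ln_27)
    then have 2: "ln (3 + L * real (Suc l)) \<le> ln (ln (27 * y l))"
      using L f by (subst ln_le_cancel_iff) (auto simp: add_pos_nonneg)
    have pos: "0 < ln (3 + L * real (Suc l))"
      using L by (intro ln_gt_zero) (simp add: add_pos_nonneg)
    have "y l * (2 * ln (3 * y l)) ^ M / majorant M \<eta> (y l)
        = 2 ^ M / (ln (3 * y l) * ln (ln (27 * y l)) powr (1 + \<eta>))"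
      unfolding majorant_def using y1 f by (simp add: power_mult_distrib divide_simps)
    also have "\<dots> \<le> 2 ^ M / (L * real (Suc l) * ln (3 + L * real (Suc l)) powr (1 + \<eta>))"
      using 1 2 L \<eta> f pos
      by (intro divide_left_mono mult_mono powr_mono2 mult_pos_pos) auto
    finally have "y l * (2 * ln (3 * y l)) ^ M / majorant M \<eta> (y l)
        \<le> 2 ^ M / L * (1 / (real (Suc l) * ln (3 + L * real (Suc l)) powr (1 + \<eta>)))"
      by simp
    moreover have "0 \<le> y l * (2 * ln (3 * y l)) ^ M / majorant M \<eta> (y l)"
      using y1 f majorant_pos[OF y1, of M \<eta>] by simp
    ultimately show "norm (y l * (2 * ln (3 * y l)) ^ M / majorant M \<eta> (y l))
        \<le> 2 ^ M / L * (1 / (real (Suc l) * ln (3 + L * real (Suc l)) powr (1 + \<eta>)))"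
      by simp
  qed
qed

section \<open>Almost sure bounds\<close>

lemma ennreal_obtain_real_bound:
  assumes "x < (top :: ennreal)" "0 < d"
  obtains c where "0 \<le> c" "x \<le> ennreal (c * d)"
proof
  show "0 \<le> enn2real x / d" using assms by simp
  show "x \<le> ennreal (enn2real x / d * d)" using assms by simp
qed

lemma AE_sum_F_le_majorant:
  fixes \<mu> :: "(circle ^ 'n ^ 'm) measure" and Y :: "nat \<Rightarrow> (int ^ 'n) set"
  assumes haar: "normalized_haar_measure \<mu>" and \<eta>: "0 < \<eta>" and C: "1 < C"
    and fin: "\<And>l. finite (Y l)" and card: "\<And>l. C ^ Suc l \<le> real (card (Y l))"
  shows "AE A in \<mu>. \<exists>c>0. \<forall>l. (\<Sum>\<xi>\<in>Y l - {0}. F (mat_int_mult A \<xi>))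
    \<le> ennreal (c * majorant CARD('m) \<eta> (real (card (Y l))))"
proof -
  note [measurable] = borel_measurable_circle_norm_mat_int_mult[OF haar]
  define y where "y = (\<lambda>l. real (card (Y l)))"
  \<comment> \<open>Squaring makes the union bound over \<open>Y l\<close> summable, while
    \<open>ln (q l)\<close> is only twice \<open>ln (y l)\<close>.\<close>
  define q where "q = (\<lambda>l. card (Y l) ^ 2)"
  define D where "D = (\<lambda>l. majorant CARD('m) \<eta> (y l))"
  define E where "E = (\<lambda>l. \<Union>\<xi>\<in>Y l - {0}. \<Union>m.
    {A \<in> space \<mu>. circle_norm (mat_int_mult A \<xi> $ m) < 1 / real (q l)})"
  define G where "G = (\<lambda>l (A :: circle ^ 'n ^ 'm). \<Sum>\<xi>\<in>Y l - {0}. \<Prod>m\<in>UNIV.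
    ennreal (circle_trunc (q l) (mat_int_mult A \<xi> $ m)))"
  have Cy: "C ^ Suc l \<le> y l" for l using card by (simp add: y_def)
  have y1: "1 \<le> y l" for l
    using one_le_power[of C "Suc l"] C Cy[of l] by linarith
  have q: "0 < q l" and qy: "real (q l) = y l ^ 2" for l
    using y1[of l] by (auto simp: q_def y_def)
  have D: "0 < D l" for l
    unfolding D_def by (rule majorant_pos[OF y1])
  have fin0: "finite (Y l - {0})" and card0: "real (card (Y l - {0})) \<le> y l" for l
    using fin[of l] by (auto simp: y_def intro: card_mono)

  \<comment> \<open>Exceptional sets and Borel--Cantelli\<close>
  have E_sets: "E l \<in> sets \<mu>" for l
    unfolding E_def using fin0 by (intro sets.finite_UN) auto
  have E_le: "emeasure \<mu> (E l) \<le> ennreal (2 * real CARD('m) * (1 / C) ^ Suc l)" for l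
  proof -
    have "emeasure \<mu> (E l) \<le> (\<Sum>\<xi>\<in>Y l - {0}. emeasure \<mu> (\<Union>m.
        {A \<in> space \<mu>. circle_norm (mat_int_mult A \<xi> $ m) < 1 / real (q l)}))"
      unfolding E_def using fin0 by (intro emeasure_subadditive_finite) auto
    also have "\<dots> \<le> (\<Sum>\<xi>\<in>Y l - {0}. \<Sum>m\<in>(UNIV::'m set). ennreal (2 / real (q l)))"
    proof (rule sum_mono)
      fix \<xi> assume "\<xi> \<in> Y l - {0}"
      then have \<xi>: "\<xi> \<noteq> 0" by simp
      have "emeasure \<mu> (\<Union>m. {A \<in> space \<mu>. circle_norm (mat_int_mult A \<xi> $ m) < 1 / real (q l)})
          \<le> (\<Sum>m\<in>UNIV. emeasure \<mu> {A \<in> space \<mu>. circle_norm (mat_int_mult A \<xi> $ m) < 1 / real (q l)})"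
        by (intro emeasure_subadditive_finite) auto
      also have "\<dots> \<le> (\<Sum>m\<in>(UNIV::'m set). ennreal (2 / real (q l)))"
        by (intro sum_mono emeasure_circle_norm_less_le[OF haar \<xi> q])
      finally show "emeasure \<mu> (\<Union>m. {A \<in> space \<mu>. circle_norm (mat_int_mult A \<xi> $ m) < 1 / real (q l)})
          \<le> (\<Sum>m\<in>(UNIV::'m set). ennreal (2 / real (q l)))" .
    qed
    also have "\<dots> = ennreal (real (card (Y l - {0})) * (real CARD('m) * (2 / real (q l))))"
      by (simp add: ennreal_of_nat_eq_real_of_nat ennreal_mult[symmetric])
    also have "\<dots> \<le> ennreal (2 * real CARD('m) * (1 / C) ^ Suc l)"
    proof (rule ennreal_leI)
      have "real (card (Y l - {0})) * (real CARD('m) * (2 / real (q l)))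
          \<le> y l * (real CARD('m) * (2 / real (q l)))"
        by (intro mult_right_mono card0) simp
      also have "\<dots> = 2 * real CARD('m) * (1 / y l)"
        using y1[of l] by (simp add: qy power2_eq_square)
      also have "\<dots> \<le> 2 * real CARD('m) * (1 / C ^ Suc l)"
        using Cy[of l] C y1[of l] by (intro mult_left_mono divide_left_mono) auto
      finally show "real (card (Y l - {0})) * (real CARD('m) * (2 / real (q l)))
          \<le> 2 * real CARD('m) * (1 / C) ^ Suc l"
        by (simp add: power_one_over)
    qed
    finally show ?thesis .
  qed
  have "summable (\<lambda>l. 2 * real CARD('m) * (1 / C) ^ Suc l)"
    using C by (intro summable_mult) (simp only: summable_Suc_iff, simp add: summable_geometric_iff)
  then have "summable (\<lambda>l. measure \<mu> (E l))"
  proof (rule summable_comparison_test'[where N = 0])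
    show "norm (measure \<mu> (E l)) \<le> 2 * real CARD('m) * (1 / C) ^ Suc l" for l
      unfolding measure_def real_norm_def abs_of_nonneg[OF enn2real_nonneg]
      using C by (intro enn2real_leI E_le) simp
  qed
  then have AE_E: "AE A in \<mu>. \<forall>\<^sub>F l in sequentially. A \<in> space \<mu> - E l"
    using E_sets le_less_trans[OF E_le] by (intro borel_cantelli_AE1) auto

  \<comment> \<open>Integrals of the truncated sums\<close>
  have G_meas: "G l \<in> borel_measurable \<mu>" for l
    unfolding G_def circle_trunc_def by measurable
  have G_int: "(\<integral>\<^sup>+A. G l A \<partial>\<mu>) \<le> ennreal (y l * (2 * ln (3 * y l)) ^ CARD('m))" for l
  proof -
    have "(\<integral>\<^sup>+A. G l A \<partial>\<mu>) = (\<Sum>\<xi>\<in>Y l - {0}. \<integral>\<^sup>+A. (\<Prod>m\<in>UNIV.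
        ennreal (circle_trunc (q l) (mat_int_mult A \<xi> $ m))) \<partial>\<mu>)"
      unfolding G_def circle_trunc_def by (rule nn_integral_sum) measurable
    also have "\<dots> \<le> (\<Sum>\<xi>\<in>Y l - {0}. ennreal ((2 + ln (real (q l))) ^ CARD('m)))"
      by (intro sum_mono nn_integral_circle_trunc_le[OF haar _ q]) simp
    also have "\<dots> = ennreal (real (card (Y l - {0})) * (2 + ln (real (q l))) ^ CARD('m))"
      using y1[of l] by (simp add: ennreal_of_nat_eq_real_of_nat ennreal_mult qy)
    also have "\<dots> \<le> ennreal (y l * (2 * ln (3 * y l)) ^ CARD('m))"
    proof (intro ennreal_leI mult_mono power_mono card0)
      have "2 + ln (real (q l)) = 2 * (1 + ln (y l))"
        using y1[of l] by (simp add: qy ln_realpow)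
      also have "\<dots> \<le> 2 * ln (3 * y l)"
        using y1[of l] ln_3_ge_1 by (simp add: ln_mult)
      finally show "2 + ln (real (q l)) \<le> 2 * ln (3 * y l)" .
    qed (use y1[of l] in \<open>auto simp: qy\<close>)
    finally show ?thesis .
  qed
  define a where "a = (\<lambda>l. y l * (2 * ln (3 * y l)) ^ CARD('m) / D l)"
  have a_summable: "summable a"
    unfolding a_def D_def by (rule summable_majorant_ratio[OF C \<eta> Cy])
  have a_nonneg: "0 \<le> a l" for l
    using y1[of l] D[of l] majorant_factors_ge_1(1)[OF y1, of l] by (simp add: a_def)
  \<comment> \<open>The whole series of normalized sums is integrated: if its integral is finite,
    the series is finite almost everywhere, and its value bounds all its terms at once.\<close>
  have "(\<integral>\<^sup>+A. (\<Sum>l. ennreal (1 / D l) * G l A) \<partial>\<mu>) = (\<Sum>l. \<integral>\<^sup>+A. ennreal (1 / D l) * G l A \<partial>\<mu>)"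
    using G_meas by (intro nn_integral_suminf) measurable
  also have "\<dots> \<le> (\<Sum>l. ennreal (a l))"
  proof (intro suminf_le summableI)
    fix l
    have "(\<integral>\<^sup>+A. ennreal (1 / D l) * G l A \<partial>\<mu>) = ennreal (1 / D l) * (\<integral>\<^sup>+A. G l A \<partial>\<mu>)"
      by (rule nn_integral_cmult[OF G_meas])
    also have "\<dots> \<le> ennreal (1 / D l) * ennreal (y l * (2 * ln (3 * y l)) ^ CARD('m))"
      by (intro mult_left_mono G_int) simp
    also have "\<dots> = ennreal (a l)"
      using D[of l] y1[of l] majorant_factors_ge_1(1)[OF y1, of l]
      by (simp add: a_def ennreal_mult[symmetric])
    finally show "(\<integral>\<^sup>+A. ennreal (1 / D l) * G l A \<partial>\<mu>) \<le> ennreal (a l)" .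
  qed
  also have "\<dots> = ennreal (\<Sum>l. a l)"
    using a_nonneg a_summable by (intro suminf_ennreal2) auto
  finally have "(\<integral>\<^sup>+A. (\<Sum>l. ennreal (1 / D l) * G l A) \<partial>\<mu>) \<noteq> \<infinity>"
    by (auto simp: top_unique)
  then have AE_G: "AE A in \<mu>. (\<Sum>l. ennreal (1 / D l) * G l A) \<noteq> \<infinity>"
    using G_meas by (intro nn_integral_PInf_AE) measurable

  \<comment> \<open>A uniform constant for almost every matrix\<close>
  from AE_E AE_G AE_circle_norm_pos[OF haar] show ?thesis
  proof eventually_elim
    fix A assume A_E: "\<forall>\<^sub>F l in sequentially. A \<in> space \<mu> - E l"
      and A_G: "(\<Sum>l. ennreal (1 / D l) * G l A) \<noteq> \<infinity>"
      and A_pos: "\<forall>\<xi>. \<xi> \<noteq> 0 \<longrightarrow> (\<forall>m. circle_norm (mat_int_mult A \<xi> $ m) > 0)"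
    define T where "T = (\<lambda>l. \<Sum>\<xi>\<in>Y l - {0}. F (mat_int_mult A \<xi>))"
    have "T l < top" for l
      unfolding T_def using A_pos by (auto simp: fin intro!: F_less_top)
    then have "\<exists>c\<ge>0. T l \<le> ennreal (c * D l)" for l
      using ennreal_obtain_real_bound[of "T l" "D l"] D[of l] by metis
    then obtain b where b: "\<And>l. 0 \<le> b l" "\<And>l. T l \<le> ennreal (b l * D l)" by metis
    obtain l0 where l0: "\<And>l. l0 \<le> l \<Longrightarrow> A \<in> space \<mu> - E l"
      using A_E by (auto simp: eventually_sequentially)
    obtain s where s: "0 \<le> s" "(\<Sum>l. ennreal (1 / D l) * G l A) = ennreal s"
      using A_G by (cases "\<Sum>l. ennreal (1 / D l) * G l A") auto
    \<comment> \<open>From \<open>l0\<close> on the truncation changes nothing, so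
      \<open>T l / D l\<close> is a single term of the series with sum \<open>s\<close>.\<close>
    have large: "T l \<le> ennreal (s * D l)" if l: "l0 \<le> l" for l
    proof -
      have "T l = G l A"
        unfolding T_def G_def
      proof (intro sum.cong refl F_eq_prod_circle_trunc q)
        fix \<xi> m assume "\<xi> \<in> Y l - {0}"
        then show "1 / real (q l) \<le> circle_norm (mat_int_mult A \<xi> $ m)"
          using l0[OF l] by (auto simp: E_def not_less)
      qed
      also have "\<dots> = ennreal (D l) * (ennreal (1 / D l) * G l A)"
        using D[of l] by (simp add: mult.assoc[symmetric] ennreal_mult[symmetric])
      also have "\<dots> \<le> ennreal (D l) * ennreal s"
        unfolding s(2)[symmetric]
        using sum_le_suminf[OF summableI, of "{l}" "\<lambda>l. ennreal (1 / D l) * G l A"]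
        by (intro mult_left_mono) simp_all
      finally show ?thesis
        using s(1) D[of l] by (simp add: ennreal_mult mult.commute)
    qed
    \<comment> \<open>The finite sum dominates every \<open>b l\<close> below \<open>l0\<close>,
      \<open>s\<close> serves the remaining indices, and 1 ensures positivity.\<close>
    define c where "c = 1 + s + (\<Sum>l<l0. b l)"
    have "0 \<le> (\<Sum>l<l0. b l)" using b(1) by (intro sum_nonneg) auto
    then have c: "0 < c" "s \<le> c" using s(1) by (auto simp: c_def)
    have "b l \<le> c" if "l < l0" for l
      using member_le_sum[of l "{..<l0}" b] that b(1) s(1) by (simp add: c_def)
    then have "T l \<le> ennreal (c * D l)" for l
      using c b(2)[of l] large[of l] D[of l]
      by (cases "l0 \<le> l") (auto intro: order_trans ennreal_leI mult_right_mono)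
    then show "\<exists>c>0. \<forall>l. (\<Sum>\<xi>\<in>Y l - {0}. F (mat_int_mult A \<xi>))
        \<le> ennreal (c * majorant CARD('m) \<eta> (real (card (Y l))))"
      using c(1) by (auto simp: T_def D_def y_def)
  qed
qed

theorem corollary1p4:
  fixes Y :: "nat \<Rightarrow> (int ^ 'n) set"
    and \<XX> :: "(int ^ 'n) set set"
    and \<eta> C\<^sub>1 C\<^sub>2 :: real
    and \<mu>\<^sub>1 :: "(circle ^ 'n ^ 'm) measure"
  assumes haar: "normalized_haar_measure \<mu>\<^sub>1"
    and "\<eta> > 0" and "C\<^sub>1 > 1" and "C\<^sub>2 > 1"
    and "\<And>l. l \<ge> 1 \<Longrightarrow> finite (Y l)"
    and "\<And>l. l \<ge> 1 \<Longrightarrow> C\<^sub>1 ^ l \<le> real (card (Y l))"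
    and "\<XX> = (\<Union>l\<in>{1..}. {X. X \<subseteq> Y l \<and> real (card (Y l)) \<le> C\<^sub>2 * real (card X)})"
  shows "AE A in \<mu>\<^sub>1. \<exists>c>0. \<forall>X\<in>\<XX>.
           (\<Sum>\<xi>\<in>X - {0}. F (mat_int_mult A \<xi>))
             \<le> ennreal (c * real (card X) * ln (3 * real (card X)) ^ (CARD('m) + 1)
                        * ln (ln (27 * real (card X))) powr (1 + \<eta>))"
proof -
  obtain K where K: "0 < K"
    "\<And>x. 1 \<le> x \<Longrightarrow> majorant CARD('m) \<eta> (C\<^sub>2 * x) \<le> K * majorant CARD('m) \<eta> x"
    using majorant_mult_le[of C\<^sub>2 \<eta> "CARD('m)"] assms(2,4) by (metis less_imp_le)
  \<comment> \<open>The hypotheses start at index 1, so the estimate is applied to the sequence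
    shifted by \<open>Suc\<close>.\<close>
  have "AE A in \<mu>\<^sub>1. \<exists>c>0. \<forall>l. (\<Sum>\<xi>\<in>Y (Suc l) - {0}. F (mat_int_mult A \<xi>))
      \<le> ennreal (c * majorant CARD('m) \<eta> (real (card (Y (Suc l)))))"
    by (intro AE_sum_F_le_majorant[OF haar assms(2,3)] assms(5,6)) simp_all
  then show ?thesis
  proof eventually_elim
    fix A assume "\<exists>c>0. \<forall>l. (\<Sum>\<xi>\<in>Y (Suc l) - {0}. F (mat_int_mult A \<xi>))
      \<le> ennreal (c * majorant CARD('m) \<eta> (real (card (Y (Suc l)))))"
    then obtain c where c: "0 < c" "\<And>l. (\<Sum>\<xi>\<in>Y (Suc l) - {0}. F (mat_int_mult A \<xi>))
      \<le> ennreal (c * majorant CARD('m) \<eta> (real (card (Y (Suc l)))))" by blast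
    have "(\<Sum>\<xi>\<in>X - {0}. F (mat_int_mult A \<xi>)) \<le> ennreal (c * K * majorant CARD('m) \<eta> (real (card X)))"
      if X: "X \<in> \<XX>" for X
    proof -
      obtain l where l: "1 \<le> l" "X \<subseteq> Y l" "real (card (Y l)) \<le> C\<^sub>2 * real (card X)"
        using X assms(7) by auto
      obtain k where k: "l = Suc k" using l(1) by (cases l) auto
      have "1 \<le> C\<^sub>1 ^ l" using assms(3) by (intro one_le_power) simp
      then have Yl: "1 \<le> real (card (Y l))" using assms(6)[OF l(1)] by linarith
      have "card X \<noteq> 0" using Yl l(3) by (intro notI) simp
      then have x1: "1 \<le> real (card X)" by simp
      \<comment> \<open>Passing from \<open>X\<close> to \<open>Y l\<close> only adds nonnegative
        terms. The resulting majorant at the size of \<open>Y l\<close> is brought back to the size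
        of \<open>X\<close> by monotonicity and the scaling constant \<open>K\<close>, which is
        independent of \<open>A\<close> and \<open>X\<close>.\<close>
      have "(\<Sum>\<xi>\<in>X - {0}. F (mat_int_mult A \<xi>)) \<le> (\<Sum>\<xi>\<in>Y l - {0}. F (mat_int_mult A \<xi>))"
        using assms(5)[OF l(1)] l(2) by (intro sum_mono2) auto
      also have "\<dots> \<le> ennreal (c * majorant CARD('m) \<eta> (real (card (Y l))))"
        using c(2)[of k] by (simp add: k)
      also have "\<dots> \<le> ennreal (c * (K * majorant CARD('m) \<eta> (real (card X))))"
        using majorant_mono[OF Yl l(3) assms(2), of "CARD('m)"] K(2)[OF x1] c(1)
        by (intro ennreal_leI mult_left_mono) auto
      finally show ?thesis by (simp add: mult.assoc)
    qed
    then show "\<exists>c>0. \<forall>X\<in>\<XX>. (\<Sum>\<xi>\<in>X - {0}. F (mat_int_mult A \<xi>))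
        \<le> ennreal (c * real (card X) * ln (3 * real (card X)) ^ (CARD('m) + 1)
                        * ln (ln (27 * real (card X))) powr (1 + \<eta>))"
      using c(1) K(1) by (intro exI[of _ "c * K"]) (simp add: majorant_def mult.assoc)
  qed
qed

end
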